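(* Let $X,Y$ be metric spaces with $X$ complete, $F:X\times\mathbb{R}_+\rightrightarrows Y$ a set-valued mapping, $t>0$ and $(x,t,y)\in\operatorname{gph}F$. Suppose that the mapping $\tau\mapsto F_\tau^{-1}(y)$ is outer semicontinuous on $[0,t)$ and there is a continuous nondecreasing function $\mu:[0,t]\to\mathbb{R}_+$ satisfying $\mu(\tau)=0$ if and only if $\tau=0$ and such that, for each pair $(u,\tau)\in F^{-1}(y)$ with $\tau\in(0,t]$ and $d(x,u)\le\mu(t)-\mu(\tau)$, there exists a pair $(u',\tau')\in F^{-1}(y)$ with $\tau'\in[0,t]$ such that $u'\ne u$ and $$\mu(\tau')\le\mu(\tau)-d(u',u).$$ Then $d(x,F_0^{-1}(y))\le\mu(t)$.
   Context: $\mathbb{R}_+=[0,\infty)$. $d(x,C)=\inf_{c\in C}d(x,c)$, with $d(x,\emptyset)=+\infty$. A set-valued mapping has possibly empty values; $\operatorname{gph}F=\{(x,t,y)\mid y\in F(x,t)\}$, $F^{-1}(y)=\{(u,\tau)\in X\times\mathbb{R}_+\mid y\in F(u,\tau)\}$, and $F_\tau^{-1}(y)=\{u\in X\mid y\in F(u,\tau)\}$. A mapping $\Phi:\mathbb{R}_+\rightrightarrows X$ is outer semicontinuous at $\bar\tau\in\mathbb{R}_+$ if $\{z\in X\mid \liminf_{\tau\to\bar\tau,\,\tau\in\mathbb{R}_+}d(z,\Phi(\tau))=0\}\subset\Phi(\bar\tau)$; it is outer semicontinuous on a set if it is so at each point of the set. *)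

theory Defs
  imports "HOL-Analysis.Analysis"
begin

text \<open>
  A set-valued mapping from \<open>X \<times> [0,\<infinity>)\<close> to \<open>Y\<close> is a total function
  \<open>F :: 'x \<times> real \<Rightarrow> 'y set\<close>. The definitions below only look at \<open>F (u, s)\<close> for
  \<open>s \<ge> 0\<close>, so the values at negative parameters are irrelevant.
\<close>

definition gph :: "('x \<times> real \<Rightarrow> 'y set) \<Rightarrow> ('x \<times> real \<times> 'y) set" where
  "gph F = {(u, s, y). 0 \<le> s \<and> y \<in> F (u, s)}"

definition inv_map :: "('x \<times> real \<Rightarrow> 'y set) \<Rightarrow> 'y \<Rightarrow> ('x \<times> real) set" where
  "inv_map F y = {(u, s). 0 \<le> s \<and> y \<in> F (u, s)}"

definition inv_slice :: "('x \<times> real \<Rightarrow> 'y set) \<Rightarrow> 'y \<Rightarrow> real \<Rightarrow> 'x set" where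
  "inv_slice F y s = {u. y \<in> F (u, s)}"

text \<open>
  The library's \<^const>\<open>infdist\<close> is \<open>0\<close> for the empty set. Here the infimum is taken in
  \<^typ>\<open>ereal\<close>, so that the distance to the empty set is \<open>\<infinity>\<close>.
\<close>

definition dist_set :: "'x::metric_space \<Rightarrow> 'x set \<Rightarrow> ereal" where
  "dist_set x C = (INF c\<in>C. ereal (dist x c))"

lemma dist_set_empty: "dist_set x {} = \<infinity>"
  by (simp add: dist_set_def top_ereal_def)

text \<open>
  The lower limit is taken over \<open>s \<ge> 0\<close> with \<open>s \<noteq> r\<close>. The convention in which
  \<open>s = r\<close> is also allowed gives a stronger notion, by \<open>osc_atI_unpunctured\<close>.
\<close>

definition osc_at :: "(real \<Rightarrow> 'x::metric_space set) \<Rightarrow> real \<Rightarrow> bool" where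
  "osc_at \<Phi> r \<longleftrightarrow>
     {z. Liminf (at r within {0..}) (\<lambda>s. dist_set z (\<Phi> s)) = 0} \<subseteq> \<Phi> r"

definition osc_on :: "real set \<Rightarrow> (real \<Rightarrow> 'x::metric_space set) \<Rightarrow> bool" where
  "osc_on S \<Phi> \<longleftrightarrow> (\<forall>r\<in>S. osc_at \<Phi> r)"

lemma osc_atI_unpunctured:
  fixes \<Phi> :: "real \<Rightarrow> 'x::metric_space set"
  assumes "{z. Liminf (inf (nhds r) (principal {0..})) (\<lambda>s. dist_set z (\<Phi> s)) = 0} \<subseteq> \<Phi> r"
  shows "osc_at \<Phi> r"
proof -
  let ?N = "inf (nhds r) (principal {0::real..})"
  have le: "at r within {0..} \<le> ?N"
    unfolding at_within_def by (intro inf_mono) auto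
  have "Liminf ?N (\<lambda>s. dist_set z (\<Phi> s)) = 0"
    if "Liminf (at r within {0..}) (\<lambda>s. dist_set z (\<Phi> s)) = 0" for z
  proof (rule antisym)
    show "Liminf ?N (\<lambda>s. dist_set z (\<Phi> s)) \<le> 0"
      unfolding that[symmetric] Liminf_def
      by (intro SUP_subset_mono) (auto intro: filter_leD[OF le])
    show "0 \<le> Liminf ?N (\<lambda>s. dist_set z (\<Phi> s))"
      by (rule Liminf_bounded) (auto simp: dist_set_def intro!: always_eventually INF_greatest)
  qed
  with assms show ?thesis unfolding osc_at_def by blast
qed

end

theory Submission imports Defs begin

text \<open>
  The distance bound is a descent argument in the style of Ekeland's variational principle.
  Weigh a pair \<open>(u, \<tau>)\<close> of \<open>F\<^sup>-\<^sup>1(y)\<close> by \<open>\<mu> \<tau>\<close>, and say that one may descend from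
  \<open>(u, \<tau>)\<close> to \<open>(u', \<tau>')\<close> if the weight drops strictly and pays for the distance travelled,
  \<open>d(u, u') \<le> \<mu> \<tau> - \<mu> \<tau>'\<close>. This relation is transitive by the triangle inequality, and the
  hypothesis on \<open>\<mu>\<close> says that every pair of positive parameter which satisfies the budget
  \<open>d(x, u) \<le> \<mu> t - \<mu> \<tau>\<close> can descend further; the budget is then inherited. A pair
  of parameter \<open>0\<close> within the budget is exactly a point of \<open>F\<^sub>0\<^sup>-\<^sup>1(y)\<close> at distance at most
  \<open>\<mu> t\<close> from \<open>x\<close>, so suppose that there is none.

  Starting from \<open>(x, t)\<close>, descend greedily (\<open>greedy_descent\<close>): each step realises at least half of
  the drop in weight that is still available. The points form a Cauchy sequence, because the
  distances are dominated by decrements of the convergent sequence of weights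
  (\<open>Cauchy_if_dist_le_decrement\<close>), and the parameters decrease strictly to some \<open>r < t\<close>.
  Outer semicontinuity at \<open>r\<close> puts the limit pair back into \<open>F\<^sup>-\<^sup>1(y)\<close>
  (\<open>osc_at_sequential_limit\<close>). One can descend from every term of the sequence to the limit pair,
  and from there once more to a pair of strictly smaller weight. But a greedy sequence leaves no
  room below its limit weight: a contradiction.
\<close>

text \<open>
  Choosing each successor so that its weight is at most the midpoint of the current weight and the
  infimum over all successors makes the last inequality hold. Once the weights
  \<open>\<phi> (s n)\<close> converge, that inequality passes to the limit and bounds \<open>\<phi> z\<close> from below by
  \<open>lim (\<phi> (s n))\<close> for every \<open>z\<close> that lies below the whole sequence.
\<close>

lemma greedy_descent:
  fixes \<phi> :: "'a \<Rightarrow> real"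
  assumes a: "a \<in> S"
    and bdd: "bdd_below (\<phi> ` S)"
    and decr: "\<And>p q. R p q \<Longrightarrow> \<phi> q < \<phi> p"
    and succ: "\<And>p. p \<in> S \<Longrightarrow> \<exists>q\<in>S. R p q"
  obtains s where "s 0 = a" "\<And>n. s n \<in> S" "\<And>n. R (s n) (s (Suc n))"
    "\<And>n z. z \<in> S \<Longrightarrow> R (s n) z \<Longrightarrow> 2 * \<phi> (s (Suc n)) - \<phi> (s n) \<le> \<phi> z"
proof -
  define I where "I p = Inf (\<phi> ` {q \<in> S. R p q})" for p
  have bdd': "bdd_below (\<phi> ` {q \<in> S. R p q})" for p
    by (rule bdd_below_mono[OF bdd]) auto
  have I_le: "I p \<le> \<phi> z" if "z \<in> S" "R p z" for p z
    unfolding I_def by (rule cInf_lower[OF _ bdd']) (use that in auto)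
  have step: "\<exists>q\<in>S. R p q \<and> 2 * \<phi> q - \<phi> p \<le> I p" if p: "p \<in> S" for p
  proof -
    from succ[OF p] obtain q0 where q0: "q0 \<in> S" "R p q0" by blast
    have "I p < \<phi> p" using I_le[OF q0] decr[OF q0(2)] by simp
    then have "I p < (\<phi> p + I p) / 2" by simp
    moreover have "\<phi> ` {q \<in> S. R p q} \<noteq> {}" using q0 by auto
    ultimately obtain q where "q \<in> S" "R p q" "\<phi> q < (\<phi> p + I p) / 2"
      using cInf_lessD[of "\<phi> ` {q \<in> S. R p q}" "(\<phi> p + I p) / 2"] unfolding I_def by auto
    then show ?thesis by (intro bexI[of _ q]) auto
  qed
  have "\<exists>s. \<forall>n. (s n \<in> S \<and> (n = 0 \<longrightarrow> s n = a)) \<and>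
      (R (s n) (s (Suc n)) \<and> 2 * \<phi> (s (Suc n)) - \<phi> (s n) \<le> I (s n))"
    by (rule dependent_nat_choice) (use a step in auto)
  then obtain s where s: "\<And>n. s n \<in> S" "s 0 = a" "\<And>n. R (s n) (s (Suc n))"
    "\<And>n. 2 * \<phi> (s (Suc n)) - \<phi> (s n) \<le> I (s n)" by blast
  show thesis
    by (rule that[of s]) (use s I_le order_trans in blast)+
qed

lemma Cauchy_if_dist_le_decrement:
  fixes u :: "nat \<Rightarrow> 'x::metric_space" and a :: "nat \<Rightarrow> real"
  assumes dist: "\<And>m n. m \<le> n \<Longrightarrow> dist (u m) (u n) \<le> a m - a n"
    and "convergent a"
  shows "Cauchy u"
proof (rule CauchyI')
  fix e :: real assume "e > 0"
  with convergent_Cauchy[OF assms(2)] obtain M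
    where M: "\<And>m n. m \<ge> M \<Longrightarrow> n \<ge> M \<Longrightarrow> dist (a m) (a n) < e"
    unfolding Cauchy_def by blast
  have "dist (u m) (u n) < e" if "m \<ge> M" "n > m" for m n
    using dist[of m n] M[of m n] that by (auto simp: dist_real_def)
  then show "\<exists>M. \<forall>m\<ge>M. \<forall>n>m. dist (u m) (u n) < e" by blast
qed

text \<open>
  The lower limit that defines outer semicontinuity ignores the parameter \<open>r\<close> itself, so
  only sequences of parameters that avoid \<open>r\<close> can be used to bound it from above.
\<close>

lemma osc_at_sequential_limit:
  assumes osc: "osc_at \<Phi> r"
    and \<tau>: "\<tau> \<longlonglongrightarrow> r" "\<And>n. 0 \<le> \<tau> n" "\<And>n. \<tau> n \<noteq> r"
    and u: "u \<longlonglongrightarrow> z" "\<And>n. u n \<in> \<Phi> (\<tau> n)"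
  shows "z \<in> \<Phi> r"
proof -
  let ?f = "\<lambda>s. dist_set z (\<Phi> s)"
  have lim: "filterlim \<tau> (at r within {0..}) sequentially"
    using \<tau> by (simp add: filterlim_at)
  have "Liminf (at r within {0..}) ?f = 0"
  proof (rule antisym)
    have "Liminf (at r within {0..}) ?f \<le> Liminf (filtermap \<tau> sequentially) ?f"
      unfolding Liminf_def
      by (intro SUP_subset_mono) (use lim in \<open>auto simp: filterlim_def filter_leD\<close>)
    also have "\<dots> \<le> liminf (\<lambda>n. ?f (\<tau> n))"
      by (rule Liminf_filtermap_le)
    also have "\<dots> \<le> liminf (\<lambda>n. ereal (dist z (u n)))"
      by (intro Liminf_mono always_eventually)
        (use u(2) in \<open>auto simp: dist_set_def intro: INF_lower\<close>)
    also have "\<dots> = 0"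
    proof -
      have "(\<lambda>n. dist z (u n)) \<longlonglongrightarrow> 0"
        using tendsto_dist[OF tendsto_const u(1), of z] by simp
      then have "(\<lambda>n. ereal (dist z (u n))) \<longlonglongrightarrow> 0"
        by (simp add: zero_ereal_def)
      then show ?thesis by (intro lim_imp_Liminf) auto
    qed
    finally show "Liminf (at r within {0..}) ?f \<le> 0" .
    show "0 \<le> Liminf (at r within {0..}) ?f"
      by (rule Liminf_bounded)
        (auto simp: dist_set_def intro!: always_eventually INF_greatest)
  qed
  with osc show ?thesis unfolding osc_at_def by blast
qed

theorem theorem2p12:
  fixes F :: "'x::complete_space \<times> real \<Rightarrow> 'y::metric_space set"
    and \<mu> :: "real \<Rightarrow> real" and t :: real and x :: 'x and y :: 'y
  assumes "0 < t"
    and "(x, t, y) \<in> gph F"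
    and "osc_on {0..<t} (\<lambda>\<tau>. inv_slice F y \<tau>)"
    and "continuous_on {0..t} \<mu>"
    and "mono_on {0..t} \<mu>"
    and "\<forall>\<tau>\<in>{0..t}. 0 \<le> \<mu> \<tau>"
    and "\<forall>\<tau>\<in>{0..t}. \<mu> \<tau> = 0 \<longleftrightarrow> \<tau> = 0"
    and "\<forall>u \<tau>. (u, \<tau>) \<in> inv_map F y \<and> \<tau> \<in> {0<..t} \<and> dist x u \<le> \<mu> t - \<mu> \<tau> \<longrightarrow>
           (\<exists>u' \<tau>'. (u', \<tau>') \<in> inv_map F y \<and> \<tau>' \<in> {0..t} \<and> u' \<noteq> u \<and>
              \<mu> \<tau>' \<le> \<mu> \<tau> - dist u' u)"
  shows "dist_set x (inv_slice F y 0) \<le> ereal (\<mu> t)"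
proof (rule ccontr)
  assume far: "\<not> dist_set x (inv_slice F y 0) \<le> ereal (\<mu> t)"
  have \<mu>0: "\<mu> 0 = 0" using assms(1,7) by auto
  define S where
    "S = {(u, \<tau>). (u, \<tau>) \<in> inv_map F y \<and> \<tau> \<in> {0..t} \<and> dist x u \<le> \<mu> t - \<mu> \<tau>}"
  define R where
    "R p q \<longleftrightarrow> dist (fst p) (fst q) \<le> \<mu> (snd p) - \<mu> (snd q) \<and> \<mu> (snd q) < \<mu> (snd p)"
    for p q :: "'x \<times> real"
  have R_trans: "R p w" if "R p q" "R q w" for p q w
    using that dist_triangle[of "fst p" "fst w" "fst q"] unfolding R_def by linarith
  have zero_free: "0 < \<tau>" if "(u, \<tau>) \<in> S" for u \<tau>
  proof (rule ccontr)
    assume "\<not> 0 < \<tau>"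
    with that have "\<tau> = 0" by (auto simp: S_def)
    with that \<mu>0 have "u \<in> inv_slice F y 0" "dist x u \<le> \<mu> t"
      by (auto simp: S_def inv_map_def inv_slice_def)
    then have "dist_set x (inv_slice F y 0) \<le> ereal (\<mu> t)"
      unfolding dist_set_def by (intro INF_lower2[of u]) auto
    with far show False ..
  qed
  have succ: "\<exists>q\<in>S. R p q" if "p \<in> S" for p
  proof -
    obtain u \<tau> where p: "p = (u, \<tau>)" by fastforce
    with that zero_free have
      "(u, \<tau>) \<in> inv_map F y \<and> \<tau> \<in> {0<..t} \<and> dist x u \<le> \<mu> t - \<mu> \<tau>"
      by (auto simp: S_def)
    moreover from this obtain u' \<tau>' where q: "(u', \<tau>') \<in> inv_map F y" "\<tau>' \<in> {0..t}"
      "u' \<noteq> u" "\<mu> \<tau>' \<le> \<mu> \<tau> - dist u' u"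
      using assms(8) by meson
    moreover have "\<mu> \<tau>' < \<mu> \<tau>" using q(4) zero_less_dist_iff[of u' u] q(3) by linarith
    ultimately have "(u', \<tau>') \<in> S" "R p (u', \<tau>')"
      using dist_triangle[of x u' u] by (auto simp: S_def R_def p dist_commute)
    then show ?thesis ..
  qed
  have "(x, t) \<in> S" using assms(1,2) by (auto simp: S_def gph_def inv_map_def)
  moreover have "bdd_below ((\<mu> \<circ> snd) ` S)"
    by (rule bdd_belowI[of _ 0]) (use assms(6) in \<open>auto simp: S_def\<close>)
  ultimately obtain s where s0: "s 0 = (x, t)" and sS: "\<And>n. s n \<in> S"
    and sR: "\<And>n. R (s n) (s (Suc n))"
    and greedy: "\<And>n z. z \<in> S \<Longrightarrow> R (s n) z \<Longrightarrow>
      2 * (\<mu> \<circ> snd) (s (Suc n)) - (\<mu> \<circ> snd) (s n) \<le> (\<mu> \<circ> snd) z"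
    by (rule greedy_descent[where R = R]) (use succ in \<open>auto simp: R_def\<close>)
  define u \<tau> where "u n = fst (s n)" and "\<tau> n = snd (s n)" for n
  have mem: "\<tau> n \<in> {0..t}" "u n \<in> inv_slice F y (\<tau> n)" for n
    using sS[of n] by (auto simp: S_def u_def \<tau>_def inv_map_def inv_slice_def)
  have \<mu>_less: "\<mu> (\<tau> (Suc n)) < \<mu> (\<tau> n)" for n
    using sR[of n] by (auto simp: R_def \<tau>_def)
  have \<tau>_less: "\<tau> (Suc n) < \<tau> n" for n
  proof (rule ccontr)
    assume "\<not> \<tau> (Suc n) < \<tau> n"
    then have "\<mu> (\<tau> n) \<le> \<mu> (\<tau> (Suc n))" by (intro mono_onD[OF assms(5)]) (use mem in auto)
    with \<mu>_less[of n] show False by simp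
  qed
  have dist_u: "dist (u m) (u n) \<le> \<mu> (\<tau> m) - \<mu> (\<tau> n)" if "m \<le> n" for m n
    using that
  proof (induction n rule: dec_induct)
    case (step n)
    with sR[of n] dist_triangle[of "u m" "u (Suc n)" "u n"] show ?case
      by (auto simp: R_def u_def \<tau>_def)
  qed simp
  \<comment> \<open>The strict decrease keeps the parameters off their limit, as the punctured lower limit
    requires, and keeps that limit below \<open>t\<close>, where outer semicontinuity is assumed.\<close>
  have "decseq \<tau>" using \<tau>_less by (intro decseq_SucI less_imp_le)
  then obtain r where r: "\<tau> \<longlonglongrightarrow> r" "\<And>n. r \<le> \<tau> n"
    using decseq_convergent[of \<tau> 0] mem(1) by (metis atLeastAtMost_iff)
  have r_less: "r < \<tau> n" for n using r(2)[of "Suc n"] \<tau>_less[of n] by simp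
  have "0 \<le> r" using r(1) by (rule LIMSEQ_le_const) (use mem(1) in auto)
  moreover have "r < t" using r_less[of 0] by (simp add: \<tau>_def s0)
  ultimately have r_mem: "r \<in> {0..<t}" by simp
  have lim_\<mu>: "(\<lambda>n. \<mu> (\<tau> n)) \<longlonglongrightarrow> \<mu> r"
    by (rule continuous_on_tendsto_compose[OF assms(4) r(1)]) (use r_mem mem(1) in auto)
  have "Cauchy u"
    using dist_u lim_\<mu> by (intro Cauchy_if_dist_le_decrement) (auto simp: convergent_def)
  then obtain z where z: "u \<longlonglongrightarrow> z" using Cauchy_convergent convergent_def by blast
  have dist_z: "dist (u n) z \<le> \<mu> (\<tau> n) - \<mu> r" for n
    using tendsto_dist[OF tendsto_const z, of "u n"] tendsto_diff[OF tendsto_const lim_\<mu>, of "\<mu> (\<tau> n)"]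
    by (rule LIMSEQ_le) (use dist_u in auto)
  have "z \<in> inv_slice F y r"
    using assms(3) r_mem
    by (intro osc_at_sequential_limit[OF _ r(1) _ _ z])
      (use mem r_less in \<open>auto simp: osc_on_def less_imp_neq[symmetric]\<close>)
  with r_mem dist_z[of 0] have zS: "(z, r) \<in> S"
    by (auto simp: S_def u_def \<tau>_def s0 inv_slice_def inv_map_def)
  have R_z: "R (s n) (z, r)" for n
  proof -
    have "\<mu> r \<le> \<mu> (\<tau> (Suc n))" using dist_z[of "Suc n"] zero_le_dist[of "u (Suc n)" z] by linarith
    with \<mu>_less[of n] dist_z[of n] show ?thesis by (auto simp: R_def u_def \<tau>_def)
  qed
  from succ[OF zS] obtain w where w: "w \<in> S" "R (z, r) w" by blast
  have "2 * \<mu> (\<tau> (Suc n)) - \<mu> (\<tau> n) \<le> \<mu> (snd w)" for n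
    using greedy[OF w(1) R_trans[OF R_z w(2)], of n] by (simp add: \<tau>_def)
  moreover have "(\<lambda>n. 2 * \<mu> (\<tau> (Suc n)) - \<mu> (\<tau> n)) \<longlonglongrightarrow> 2 * \<mu> r - \<mu> r"
    by (intro tendsto_intros lim_\<mu> LIMSEQ_Suc)
  ultimately have "\<mu> r \<le> \<mu> (snd w)" using LIMSEQ_le_const2 by fastforce
  with w(2) show False by (simp add: R_def)
qed

end
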